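(* There exists a constant $c>0$ such that for every $T>0$ and every $g\in H^{1/2}(0,T)\cap L^\infty(0,T)$, $$\|Ig\|_{H^{1/2}(0,T)}\le c\cdot\max\{\|\mathcal N\|_{H^{1/2}(0,T)},\mathcal N(T)\}\,\left(\|g\|_{L^\infty(0,T)}+\|g\|_{H^{1/2}(0,T)}\right),$$ with $c$ independent of $g$ and $T$.
   Context: $\mathcal I(x)=\int_0^\infty\frac{x^{s-1}}{\Gamma(s)}\,ds$ for $x>0$ (the Volterra function of order $-1$, which is positive and locally integrable on $[0,\infty)$), $(Ig)(x)=\int_0^x\mathcal I(x-s)g(s)\,ds$, and $\mathcal N(x)=\int_0^x\mathcal I(s)\,ds$ for $x\ge0$. Functions are real-valued. $H^{1/2}(0,T)=\{g\in L^2(0,T):[g]_{\dot H^{1/2}(0,T)}<\infty\}$ with $[g]_{\dot H^{1/2}(0,T)}^2=\int_{[0,T]^2}\frac{|g(x)-g(y)|^2}{|x-y|^{2}}\,dy\,dx$ and $\|g\|_{H^{1/2}(0,T)}^2=\|g\|_{L^2(0,T)}^2+[g]_{\dot H^{1/2}(0,T)}^2$. *)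

theory Defs
  imports "HOL-Analysis.Analysis" "HOL-Probability.Essential_Supremum"
begin

definition volterra :: "real \<Rightarrow> real" where
  "volterra x = (LINT s:{0<..}|lebesgue. x powr (s - 1) / Gamma s)"

definition volterra_conv :: "(real \<Rightarrow> real) \<Rightarrow> real \<Rightarrow> real" where
  "volterra_conv g x = (LINT s:{0<..<x}|lebesgue. volterra (x - s) * g s)"

definition volterra_prim :: "real \<Rightarrow> real" where
  "volterra_prim x = (LINT s:{0<..<x}|lebesgue. volterra s)"

text \<open>
  Function spaces on \<open>(0,T)\<close> are sets of representatives \<open>real \<Rightarrow> real\<close>, whose values
  outside \<open>(0,T)\<close> play no role. All norms take values in \<open>[0,\<infinity>]\<close>, so that an inequality
  between norms with finite right-hand side entails membership of the left-hand function
  in the space. For the same reason the \<open>L\<^sup>2\<close> norm of a non-measurable function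
  is \<open>\<infinity>\<close>, which is also the library's convention for \<^const>\<open>esssup\<close>.
\<close>

definition ennsqrt :: "ennreal \<Rightarrow> ennreal" where
  "ennsqrt a = (if a = \<infinity> then \<infinity> else ennreal (sqrt (enn2real a)))"

definition L2_norm :: "real \<Rightarrow> (real \<Rightarrow> real) \<Rightarrow> ennreal" where
  "L2_norm T g =
     (if g \<in> borel_measurable (lebesgue_on {0<..<T})
      then ennsqrt (\<integral>\<^sup>+ x\<in>{0<..<T}. ennreal (\<bar>g x\<bar>\<^sup>2) \<partial>lebesgue) else \<infinity>)"

definition L2_space :: "real \<Rightarrow> (real \<Rightarrow> real) set" where
  "L2_space T = {g \<in> borel_measurable (lebesgue_on {0<..<T}). L2_norm T g < \<infinity>}"

definition Linf_norm :: "real \<Rightarrow> (real \<Rightarrow> real) \<Rightarrow> ennreal" where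
  "Linf_norm T g = esssup (lebesgue_on {0<..<T}) (\<lambda>x. ennreal \<bar>g x\<bar>)"

definition Linf_space :: "real \<Rightarrow> (real \<Rightarrow> real) set" where
  "Linf_space T = {g \<in> borel_measurable (lebesgue_on {0<..<T}). Linf_norm T g < \<infinity>}"

text \<open>
  Since \<open>z / 0 = 0\<close>, the integrand vanishes on the diagonal, a null set. The open square
  differs from the closed one by a null set and does not involve values of \<open>g\<close> at
  the endpoints.
\<close>

definition H12_seminorm :: "real \<Rightarrow> (real \<Rightarrow> real) \<Rightarrow> ennreal" where
  "H12_seminorm T g =
     ennsqrt (\<integral>\<^sup>+ x\<in>{0<..<T}. (\<integral>\<^sup>+ y\<in>{0<..<T}.
       ennreal (\<bar>g x - g y\<bar>\<^sup>2 / \<bar>x - y\<bar>\<^sup>2) \<partial>lebesgue) \<partial>lebesgue)"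

definition H12_space :: "real \<Rightarrow> (real \<Rightarrow> real) set" where
  "H12_space T = {g \<in> L2_space T. H12_seminorm T g < \<infinity>}"

definition H12_norm :: "real \<Rightarrow> (real \<Rightarrow> real) \<Rightarrow> ennreal" where
  "H12_norm T g = ennsqrt ((L2_norm T g)\<^sup>2 + (H12_seminorm T g)\<^sup>2)"

end

theory Submission
  imports Defs
begin

text \<open>
  Write \<open>k\<close> for the Volterra function, \<open>N\<close> for its primitive, \<open>u = k * g\<close> for the convolution and
  \<open>M\<close> for the supremum norm of \<open>g\<close>. The properties of \<open>k\<close> that drive the
  estimate are \<open>k \<ge> 0\<close> and local integrability. For \<open>y < x\<close>,
  \<open>u(x) - u(y) = \<integral>\<^sub>0\<^sup>y k(s) (g(x-s) - g(y-s)) ds + \<integral>\<^sub>y\<^sup>x k(s) g(x-s) ds\<close>.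
  The second integral is at most \<open>M (N(x) - N(y))\<close> and contributes \<open>M\<close> times the \<open>H\<^sup>1\<^sup>/\<^sup>2\<close> seminorm
  of \<open>N\<close>. By Cauchy--Schwarz the square of the first is at most
  \<open>N(T) \<integral>\<^sub>0\<^sup>y k(s) (g(x-s) - g(y-s))\<^sup>2 ds\<close>; dividing by \<open>(x-y)\<^sup>2\<close>, integrating over the square and
  translating by \<open>s\<close>, one gets at most \<open>N(T)\<^sup>2\<close> times the squared seminorm of \<open>g\<close>. Together with the
  pointwise bound \<open>\<bar>u\<bar> \<le> M N\<close> for the \<open>L\<^sup>2\<close> part, this proves the theorem with \<open>c = 2\<close>.

  The estimate of the seminorm is \<open>gagliardo_conv_le\<close>, the \<open>L\<^sup>2\<close> part rests on \<open>conv_le\<close>, and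
  \<open>volterra_locally_integrable\<close> makes them applicable to \<open>k\<close>. The first two concern Borel functions
  on the line; \<open>volterra_conv_eq\<close> and \<open>bounded_borel_representative\<close> transfer them to Lebesgue
  measurable \<open>g\<close>.
\<close>

section \<open>The Gagliardo energy\<close>

definition gagliardo_quot :: "(real \<Rightarrow> real) \<Rightarrow> real \<Rightarrow> real \<Rightarrow> real" where
  "gagliardo_quot f x y = \<bar>f x - f y\<bar>\<^sup>2 / \<bar>x - y\<bar>\<^sup>2"

text \<open>
  The squared \<open>H\<^sup>1\<^sup>/\<^sup>2\<close> seminorm. The integrals run over the whole line with respect to \<^const>\<open>lborel\<close>,
  so that Tonelli's theorem and translation invariance apply directly.
\<close>
definition gagliardo :: "real \<Rightarrow> (real \<Rightarrow> real) \<Rightarrow> ennreal" where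
  "gagliardo T f = (\<integral>\<^sup>+ x. \<integral>\<^sup>+ y. ennreal (gagliardo_quot f x y) *
      indicator {0<..<T} y * indicator {0<..<T} x \<partial>lborel \<partial>lborel)"

lemma gagliardo_quot_measurable [measurable (raw)]:
  assumes [measurable]: "f \<in> borel_measurable borel" "a \<in> borel_measurable M" "b \<in> borel_measurable M"
  shows "(\<lambda>p. gagliardo_quot f (a p) (b p)) \<in> borel_measurable M"
  unfolding gagliardo_quot_def by measurable

lemma gagliardo_quot_nonneg: "gagliardo_quot f x y \<ge> 0"
  by (simp add: gagliardo_quot_def)

section \<open>Convolution with a causal kernel\<close>

text \<open>
  Both the kernel \<open>K\<close> and the bounded function \<open>h\<close> vanish on the negative half-line, so
  \<open>\<integral>s. K s * h (x - s)\<close> is the integral over \<open>0 < s < x\<close>. Cutting the kernel off at the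
  end of the interval and extending \<open>h\<close> by zero turns every integral below into one over the
  whole line, where translations need no care about domains.
\<close>
locale causal_convolution =
  fixes K h :: "real \<Rightarrow> real" and M :: real
  assumes K_int: "integrable lborel K" and K_nonneg: "\<And>s. K s \<ge> 0" and K_zero: "\<And>s. s \<le> 0 \<Longrightarrow> K s = 0"
    and h_meas [measurable]: "h \<in> borel_measurable borel" and h_bound: "\<And>x. \<bar>h x\<bar> \<le> M"
    and h_zero: "\<And>x. x \<le> 0 \<Longrightarrow> h x = 0"
begin

lemma K_meas [measurable]: "K \<in> borel_measurable borel"
  using borel_measurable_integrable[OF K_int] by simp

lemma K_weighted_integrable:
  assumes [measurable]: "w \<in> borel_measurable borel" and "\<And>s. \<bar>w s\<bar> \<le> C"
  shows "integrable lborel (\<lambda>s. K s * w s)"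
proof (rule Bochner_Integration.integrable_bound)
  show "integrable lborel (\<lambda>s. C * K s)" using K_int by simp
  show "AE s in lborel. norm (K s * w s) \<le> norm (C * K s)"
  proof (intro AE_I2)
    fix s have "K s * \<bar>w s\<bar> \<le> K s * C" "0 \<le> C" using assms(2)[of s] K_nonneg[of s]
      by (auto intro!: mult_left_mono)
    then show "norm (K s * w s) \<le> norm (C * K s)" using K_nonneg[of s]
      by (simp add: abs_mult mult.commute)
  qed
qed simp

text \<open>
  For \<open>s < y\<close> both translates of \<open>h\<close> are kept and their difference is used. For \<open>y \<le> s < x\<close> only
  \<open>h (x - s)\<close> survives; it is bounded by \<open>M\<close>, and the mass of \<open>K\<close> on \<open>[y, x)\<close> is exactly the
  increment of the primitive of \<open>K\<close>. The cut-off \<open>s < y\<close> in the first term matters: without it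
  a jump of \<open>h\<close> at \<open>0\<close> would enter, and a jump has infinite \<open>H\<^sup>1\<^sup>/\<^sup>2\<close> seminorm.
  Writing the bound with \<open>min\<close> and absolute values makes it symmetric in \<open>x\<close> and \<open>y\<close>.
\<close>
lemma conv_incr_le:
  assumes "y \<le> x"
  shows "\<bar>(\<integral>s. K s * h (x - s) \<partial>lborel) - (\<integral>s. K s * h (y - s) \<partial>lborel)\<bar>
    \<le> (\<integral>s. K s * (indicator {..<min x y} s * \<bar>h (x - s) - h (y - s)\<bar>) \<partial>lborel)
      + M * \<bar>(\<integral>s. K s * indicator {..<x} s \<partial>lborel) - (\<integral>s. K s * indicator {..<y} s \<partial>lborel)\<bar>"
proof -
  have hd: "\<bar>h a - h b\<bar> \<le> 2 * M" for a b
    using h_bound[of a] h_bound[of b] by linarith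
  have I0: "integrable lborel (\<lambda>s. K s * h (z - s))" for z
    by (rule K_weighted_integrable[of _ M]) (auto simp: h_bound)
  have I1: "integrable lborel (\<lambda>s. K s * (indicator {..<y} s * \<bar>h (x - s) - h (y - s)\<bar>))"
    using hd order_trans[OF abs_ge_zero hd]
    by (intro K_weighted_integrable[of _ "2 * M"]) (auto simp: indicator_def)
  have I2: "integrable lborel (\<lambda>s. K s * indicator {..<z} s)" for z
    by (rule K_weighted_integrable[of _ 1]) (auto simp: indicator_def)
  have mono: "(\<integral>s. K s * indicator {..<y} s \<partial>lborel) \<le> (\<integral>s. K s * indicator {..<x} s \<partial>lborel)"
    using assms K_nonneg by (intro integral_mono I2) (auto simp: indicator_def)
  have "\<bar>(\<integral>s. K s * h (x - s) \<partial>lborel) - (\<integral>s. K s * h (y - s) \<partial>lborel)\<bar>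
      = \<bar>\<integral>s. K s * h (x - s) - K s * h (y - s) \<partial>lborel\<bar>"
    using I0 by simp
  also have "\<dots> \<le> (\<integral>s. \<bar>K s * h (x - s) - K s * h (y - s)\<bar> \<partial>lborel)"
    by (rule integral_abs_bound)
  also have "\<dots> \<le> (\<integral>s. K s * (indicator {..<y} s * \<bar>h (x - s) - h (y - s)\<bar>)
      + M * (K s * indicator {..<x} s - K s * indicator {..<y} s) \<partial>lborel)"
  proof (rule integral_mono)
    fix s
    have eq: "\<bar>K s * h (x - s) - K s * h (y - s)\<bar> = K s * \<bar>h (x - s) - h (y - s)\<bar>"
      using K_nonneg[of s] by (simp add: abs_mult flip: right_diff_distrib)
    consider "s < y" | "y \<le> s" "s < x" | "x \<le> s" "y \<le> s" using assms by linarith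
    then show "\<bar>K s * h (x - s) - K s * h (y - s)\<bar> \<le> K s * (indicator {..<y} s * \<bar>h (x - s) - h (y - s)\<bar>)
      + M * (K s * indicator {..<x} s - K s * indicator {..<y} s)"
    proof cases
      case 1 then show ?thesis using assms by (simp add: eq)
    next
      case 2 then show ?thesis
        using h_zero[of "y - s"] mult_left_mono[OF h_bound[of "x - s"] K_nonneg[of s]]
        K_nonneg[of s]
        by (simp add: abs_mult mult.commute)
    next
      case 3 then show ?thesis using h_zero[of "y - s"] h_zero[of "x - s"] by simp
    qed
  qed (use I0 I1 I2 in auto)
  also have "\<dots> = (\<integral>s. K s * (indicator {..<y} s * \<bar>h (x - s) - h (y - s)\<bar>) \<partial>lborel)
      + M * ((\<integral>s. K s * indicator {..<x} s \<partial>lborel) - (\<integral>s. K s * indicator {..<y} s \<partial>lborel))"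
    using I1 I2 by (subst Bochner_Integration.integral_add) auto
  finally show ?thesis using assms mono by (simp add: min_def)
qed

text \<open>
  The Cauchy--Schwarz inequality for the finite measure with density \<open>K\<close>, obtained from the one
  for Lebesgue measure by splitting \<open>K w\<close> as \<open>\<surd>K \<cdot> \<surd>K w\<close>.
\<close>
lemma weighted_Cauchy_Schwarz:
  assumes [measurable]: "w \<in> borel_measurable borel" and b: "\<And>s. \<bar>w s\<bar> \<le> C" and nn: "\<And>s. w s \<ge> 0"
  shows "ennreal ((\<integral>s. K s * w s \<partial>lborel)\<^sup>2)
    \<le> ennreal (integral\<^sup>L lborel K) * (\<integral>\<^sup>+s. ennreal (K s) * ennreal ((w s)\<^sup>2) \<partial>lborel)"
proof -
  have I: "integrable lborel (\<lambda>s. K s * w s)" by (rule K_weighted_integrable[of _ C]) (auto simp: b)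
  have "ennreal ((\<integral>s. K s * w s \<partial>lborel)\<^sup>2) = (\<integral>\<^sup>+s. ennreal (K s * w s) \<partial>lborel)\<^sup>2"
    using I K_nonneg nn by (subst nn_integral_eq_integral) (auto simp: ennreal_power)
  also have "(\<integral>\<^sup>+s. ennreal (K s * w s) \<partial>lborel)
      = (\<integral>\<^sup>+s. ennreal (sqrt (K s)) * ennreal (sqrt (K s) * w s) \<partial>lborel)"
    using K_nonneg nn by (intro nn_integral_cong) (simp add: mult.assoc[symmetric] flip: ennreal_mult)
  also have "\<dots>\<^sup>2 \<le> (\<integral>\<^sup>+s. ennreal (sqrt (K s))^2 \<partial>lborel) * (\<integral>\<^sup>+s. ennreal (sqrt (K s) * w s)^2 \<partial>lborel)"
    by (rule Cauchy_Schwarz_nn_integral) auto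
  also have "(\<integral>\<^sup>+s. ennreal (sqrt (K s))^2 \<partial>lborel) = ennreal (integral\<^sup>L lborel K)"
    using K_int K_nonneg by (subst nn_integral_eq_integral[symmetric]) (auto simp: ennreal_power)
  also have "(\<integral>\<^sup>+s. ennreal (sqrt (K s) * w s)^2 \<partial>lborel) = (\<integral>\<^sup>+s. ennreal (K s) * ennreal ((w s)\<^sup>2) \<partial>lborel)"
    using K_nonneg nn by (intro nn_integral_cong) (auto simp: ennreal_power power_mult_distrib ennreal_mult)
  finally show ?thesis .
qed

text \<open>
  The increment bound, squared and divided by \<open>\<bar>x - y\<bar>\<^sup>2\<close>. Since \<open>(x - s) - (y - s) = x - y\<close>, the
  denominator can be moved inside the integral over \<open>s\<close>, where it completes a difference quotient
  of \<open>h\<close> at the translated points.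
\<close>
lemma gagliardo_quot_conv_le:
  fixes x y :: real
  defines "u \<equiv> \<lambda>x. \<integral>s. K s * h (x - s) \<partial>lborel" and "N \<equiv> \<lambda>x. \<integral>s. K s * indicator {..<x} s \<partial>lborel"
  shows "ennreal (gagliardo_quot u x y)
    \<le> 2 * ennreal (integral\<^sup>L lborel K) * (\<integral>\<^sup>+s. ennreal (K s) *
          (indicator {..<min x y} s * ennreal (gagliardo_quot h (x - s) (y - s))) \<partial>lborel)
      + 2 * ennreal (M\<^sup>2) * ennreal (gagliardo_quot N x y)"
proof -
  define w where "w = (\<lambda>s. indicator {..<min x y} s * \<bar>h (x - s) - h (y - s)\<bar>)"
  define A where "A = (\<integral>s. K s * w s \<partial>lborel)"
  define d where "d = 1 / \<bar>x - y\<bar>\<^sup>2"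
  have d: "d \<ge> 0" by (simp add: d_def)
  have [measurable]: "w \<in> borel_measurable borel" unfolding w_def by measurable
  have hd: "\<bar>h a - h b\<bar> \<le> 2 * M" for a b
    using h_bound[of a] h_bound[of b] by linarith
  have w: "w s \<ge> 0" "\<bar>w s\<bar> \<le> 2 * M" for s
    using hd order_trans[OF abs_ge_zero hd] by (auto simp: w_def indicator_def)
  have "\<bar>u x - u y\<bar> \<le> A + M * \<bar>N x - N y\<bar>"
  proof (cases "y \<le> x")
    case True
    then show ?thesis using conv_incr_le[of y x] by (simp add: u_def N_def A_def w_def)
  next
    case False
    then show ?thesis using conv_incr_le[of x y]
      by (simp add: u_def N_def A_def w_def abs_minus_commute min.commute)
  qed
  then have "\<bar>u x - u y\<bar>\<^sup>2 \<le> (A + M * \<bar>N x - N y\<bar>)\<^sup>2"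
    by (rule power_mono) simp
  also have "\<dots> \<le> 2 * A\<^sup>2 + 2 * M\<^sup>2 * \<bar>N x - N y\<bar>\<^sup>2"
    using zero_le_power2[of "A - M * \<bar>N x - N y\<bar>"]
    by (simp add: power2_sum power2_diff power_mult_distrib)
  finally have "gagliardo_quot u x y \<le> (2 * A\<^sup>2 + 2 * M\<^sup>2 * \<bar>N x - N y\<bar>\<^sup>2) / \<bar>x - y\<bar>\<^sup>2"
    unfolding gagliardo_quot_def by (rule divide_right_mono) simp
  also have "\<dots> = 2 * (A\<^sup>2 * d) + 2 * M\<^sup>2 * gagliardo_quot N x y"
    by (simp add: gagliardo_quot_def d_def add_divide_distrib)
  finally have "ennreal (gagliardo_quot u x y)
     \<le> ennreal (2 * (A\<^sup>2 * d) + 2 * M\<^sup>2 * gagliardo_quot N x y)"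
    by (rule ennreal_leI)
  also have "\<dots> = 2 * (ennreal (A\<^sup>2) * ennreal d) + 2 * ennreal (M\<^sup>2) * ennreal (gagliardo_quot N x y)"
    by (simp add: ennreal_plus ennreal_mult gagliardo_quot_nonneg d)
  also have "ennreal (A\<^sup>2) * ennreal d
     \<le> ennreal (integral\<^sup>L lborel K) * (\<integral>\<^sup>+s. ennreal (K s) * ennreal ((w s)\<^sup>2) \<partial>lborel) * ennreal d"
    unfolding A_def using weighted_Cauchy_Schwarz[OF _ w(2) w(1)] by (intro mult_right_mono) auto
  also have "\<dots> = ennreal (integral\<^sup>L lborel K) *
      (\<integral>\<^sup>+s. ennreal (K s) * ennreal ((w s)\<^sup>2) * ennreal d \<partial>lborel)"
    by (subst nn_integral_multc) (auto simp: mult.assoc)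
  also have "(\<integral>\<^sup>+s. ennreal (K s) * ennreal ((w s)\<^sup>2) * ennreal d \<partial>lborel)
     = (\<integral>\<^sup>+s. ennreal (K s) * (indicator {..<min x y} s * ennreal (gagliardo_quot h (x - s) (y - s))) \<partial>lborel)"
    by (intro nn_integral_cong)
       (auto simp: w_def d_def gagliardo_quot_def indicator_def mult.assoc simp flip: ennreal_mult)
  finally show ?thesis by (simp add: mult.assoc mult_left_mono add_right_mono)
qed

text \<open>
  Translation by \<open>s\<close> maps the square \<open>(s, T)\<^sup>2\<close> to \<open>(0, T - s)\<^sup>2\<close>, a part of \<open>(0, T)\<^sup>2\<close>.
\<close>
lemma gagliardo_translate_le:
  assumes "s > 0"
  shows "(\<integral>\<^sup>+x. \<integral>\<^sup>+y. indicator {..<min x y} s * ennreal (gagliardo_quot h (x - s) (y - s)) *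
      indicator {0<..<T} y * indicator {0<..<T} x \<partial>lborel \<partial>lborel) \<le> gagliardo T h"
proof -
  define F where "F = (\<lambda>x y. ennreal (gagliardo_quot h x y) * indicator {0<..<T} y * indicator {0<..<T} x)"
  have [measurable]: "(\<lambda>p. F (fst p) (snd p)) \<in> borel_measurable (borel \<Otimes>\<^sub>M borel)"
    "F x \<in> borel_measurable borel" for x
    unfolding F_def by measurable
  have "(\<integral>\<^sup>+x. \<integral>\<^sup>+y. indicator {..<min x y} s * ennreal (gagliardo_quot h (x - s) (y - s)) *
      indicator {0<..<T} y * indicator {0<..<T} x \<partial>lborel \<partial>lborel)
    \<le> (\<integral>\<^sup>+x. \<integral>\<^sup>+y. F (x - s) (y - s) \<partial>lborel \<partial>lborel)"
    using assms by (intro nn_integral_mono) (auto simp: F_def indicator_def)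
  also have "\<dots> = (\<integral>\<^sup>+x. \<integral>\<^sup>+y. F (x - s) y \<partial>lborel \<partial>lborel)"
  proof (rule nn_integral_cong)
    fix x show "(\<integral>\<^sup>+y. F (x - s) (y - s) \<partial>lborel) = (\<integral>\<^sup>+y. F (x - s) y \<partial>lborel)"
      using nn_integral_real_affine[of "F (x - s)" 1 "- s"] by simp
  qed
  also have "\<dots> = (\<integral>\<^sup>+x. \<integral>\<^sup>+y. F x y \<partial>lborel \<partial>lborel)"
    using nn_integral_real_affine[of "\<lambda>x. \<integral>\<^sup>+y. F x y \<partial>lborel" 1 "- s"] by simp
  finally show ?thesis by (simp add: gagliardo_def F_def)
qed

text \<open>
  Integrating the pointwise bound over the square and exchanging the order of integration, each
  \<open>s\<close> contributes at most \<open>K s\<close> times the energy of \<open>h\<close>. The mass of \<open>K\<close> occurs squared: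
  once from Cauchy--Schwarz and once from this last integration.
\<close>
lemma gagliardo_conv_le:
  defines "u \<equiv> \<lambda>x. \<integral>s. K s * h (x - s) \<partial>lborel" and "N \<equiv> \<lambda>x. \<integral>s. K s * indicator {..<x} s \<partial>lborel"
  shows "gagliardo T u \<le> 2 * ennreal ((integral\<^sup>L lborel K)\<^sup>2) * gagliardo T h + 2 * ennreal (M\<^sup>2) * gagliardo T N"
proof -
  let ?P = "ennreal (integral\<^sup>L lborel K)"
  define I where "I = (indicator {0<..<T} :: real \<Rightarrow> ennreal)"
  define F where "F = (\<lambda>x y s. indicator {..<min x y} s * ennreal (gagliardo_quot h (x - s) (y - s)) * I y * I x)"
  have [measurable]: "I \<in> borel_measurable borel" unfolding I_def by measurable
  have [measurable]: "N \<in> borel_measurable borel"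
    unfolding N_def lessThan_def by measurable
  have [measurable (raw)]: "(\<lambda>p. F (a p) (b p) (c p)) \<in> borel_measurable L"
    if [measurable]: "a \<in> borel_measurable L" "b \<in> borel_measurable L" "c \<in> borel_measurable L"
    for L :: "'c measure" and a b c
    unfolding F_def lessThan_def by measurable
  have "gagliardo T u \<le> (\<integral>\<^sup>+x. \<integral>\<^sup>+y. 2 * ?P * (\<integral>\<^sup>+s. ennreal (K s) * F x y s \<partial>lborel)
      + 2 * ennreal (M\<^sup>2) * (ennreal (gagliardo_quot N x y) * I y * I x) \<partial>lborel \<partial>lborel)"
    unfolding gagliardo_def I_def[symmetric]
  proof (intro nn_integral_mono)
    fix x y
    have "ennreal (gagliardo_quot u x y) * I y * I x
      \<le> (2 * ?P * (\<integral>\<^sup>+s. ennreal (K s) * (indicator {..<min x y} s * ennreal (gagliardo_quot h (x - s) (y - s))) \<partial>lborel)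
      + 2 * ennreal (M\<^sup>2) * ennreal (gagliardo_quot N x y)) * I y * I x"
      unfolding u_def N_def by (intro mult_right_mono gagliardo_quot_conv_le) auto
    also have "\<dots> = 2 * ?P * (\<integral>\<^sup>+s. ennreal (K s) * F x y s \<partial>lborel)
      + 2 * ennreal (M\<^sup>2) * (ennreal (gagliardo_quot N x y) * I y * I x)"
      unfolding F_def
      by (simp add: I_def indicator_def distrib_right mult.assoc)
    finally show "ennreal (gagliardo_quot u x y) * I y * I x \<le> \<dots>" .
  qed
  also have "\<dots> = 2 * ?P * (\<integral>\<^sup>+x. \<integral>\<^sup>+y. \<integral>\<^sup>+s. ennreal (K s) * F x y s \<partial>lborel \<partial>lborel \<partial>lborel)
      + 2 * ennreal (M\<^sup>2) * gagliardo T N"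
  proof -
    define J where "J = (\<lambda>x y. \<integral>\<^sup>+s. ennreal (K s) * F x y s \<partial>lborel)"
    define Q where "Q = (\<lambda>x y. ennreal (gagliardo_quot N x y) * I y * I x)"
    have [measurable]: "(\<lambda>(x, y). J x y) \<in> borel_measurable (borel \<Otimes>\<^sub>M borel)"
      "(\<lambda>(x, y). Q x y) \<in> borel_measurable (borel \<Otimes>\<^sub>M borel)"
      unfolding J_def Q_def by measurable
    have "(\<integral>\<^sup>+y. 2 * ?P * J x y + 2 * ennreal (M\<^sup>2) * Q x y \<partial>lborel)
        = 2 * ?P * (\<integral>\<^sup>+y. J x y \<partial>lborel) + 2 * ennreal (M\<^sup>2) * (\<integral>\<^sup>+y. Q x y \<partial>lborel)" for x
      by (subst nn_integral_add) (auto simp: nn_integral_cmult)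
    then have "(\<integral>\<^sup>+x. \<integral>\<^sup>+y. 2 * ?P * J x y + 2 * ennreal (M\<^sup>2) * Q x y \<partial>lborel \<partial>lborel)
        = 2 * ?P * (\<integral>\<^sup>+x. \<integral>\<^sup>+y. J x y \<partial>lborel \<partial>lborel)
          + 2 * ennreal (M\<^sup>2) * (\<integral>\<^sup>+x. \<integral>\<^sup>+y. Q x y \<partial>lborel \<partial>lborel)"
      by (simp only:) (subst nn_integral_add, auto simp: nn_integral_cmult)
    then show ?thesis by (simp only: J_def Q_def I_def gagliardo_def)
  qed
  also have "(\<integral>\<^sup>+x. \<integral>\<^sup>+y. \<integral>\<^sup>+s. ennreal (K s) * F x y s \<partial>lborel \<partial>lborel \<partial>lborel)
     = (\<integral>\<^sup>+x. \<integral>\<^sup>+s. \<integral>\<^sup>+y. ennreal (K s) * F x y s \<partial>lborel \<partial>lborel \<partial>lborel)"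
    by (intro nn_integral_cong lborel_pair.Fubini') measurable
  also have "\<dots> = (\<integral>\<^sup>+s. \<integral>\<^sup>+x. \<integral>\<^sup>+y. ennreal (K s) * F x y s \<partial>lborel \<partial>lborel \<partial>lborel)"
    by (intro lborel_pair.Fubini') measurable
  also have "\<dots> = (\<integral>\<^sup>+s. ennreal (K s) * (\<integral>\<^sup>+x. \<integral>\<^sup>+y. F x y s \<partial>lborel \<partial>lborel) \<partial>lborel)"
    by (simp add: nn_integral_cmult)
  also have "\<dots> \<le> (\<integral>\<^sup>+s. ennreal (K s) * gagliardo T h \<partial>lborel)"
  proof (intro nn_integral_mono)
    fix s show "ennreal (K s) * (\<integral>\<^sup>+x. \<integral>\<^sup>+y. F x y s \<partial>lborel \<partial>lborel) \<le> ennreal (K s) * gagliardo T h"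
      using gagliardo_translate_le[of s T] K_zero[of s]
      by (cases "s > 0") (auto simp: F_def I_def intro!: mult_left_mono)
  qed
  also have "\<dots> = ?P * gagliardo T h"
    using K_int K_nonneg by (simp add: nn_integral_multc nn_integral_eq_integral)
  finally show ?thesis
    using K_nonneg by (simp add: mult.assoc mult_left_mono add_right_mono power2_eq_square ennreal_mult)
qed

lemma conv_le: "\<bar>\<integral>s. K s * h (x - s) \<partial>lborel\<bar> \<le> M * (\<integral>s. K s * indicator {..<x} s \<partial>lborel)"
proof -
  have "\<bar>\<integral>s. K s * h (x - s) \<partial>lborel\<bar> \<le> (\<integral>s. \<bar>K s * h (x - s)\<bar> \<partial>lborel)"
    by (rule integral_abs_bound)
  also have "\<dots> \<le> (\<integral>s. M * (K s * indicator {..<x} s) \<partial>lborel)"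
  proof (rule integral_mono)
    show "integrable lborel (\<lambda>s. \<bar>K s * h (x - s)\<bar>)"
      by (intro integrable_abs K_weighted_integrable[of _ M]) (auto simp: h_bound)
    show "integrable lborel (\<lambda>s. M * (K s * indicator {..<x} s))"
      by (intro integrable_mult_right K_weighted_integrable[of _ 1]) (auto simp: indicator_def)
    show "\<bar>K s * h (x - s)\<bar> \<le> M * (K s * indicator {..<x} s)" for s
      using mult_left_mono[OF h_bound[of "x - s"] K_nonneg[of s]] h_zero[of "x - s"] K_nonneg[of s]
      by (cases "s < x") (auto simp: abs_mult mult.commute)
  qed
  finally show ?thesis by simp
qed

end

section \<open>Local integrability of the Volterra function\<close>

text \<open>
  Restricting Euler's integral for \<open>\<Gamma>(s + 1)\<close> to \<open>t \<ge> A\<close>, where \<open>t\<^sup>s \<ge> A\<^sup>s\<close>, gives an elementary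
  bound showing that \<open>\<Gamma>(s + 1)\<close> outgrows every exponential.
\<close>
lemma Gamma_plus1_ge:
  assumes "s \<ge> 0" "A > 0"
  shows "A powr s * exp (- A) \<le> Gamma (s + 1 :: real)"
proof -
  have "((\<lambda>t. A powr s * exp (- 1 * t)) has_integral A powr s * (exp (- 1 * A) / 1)) {A..}"
    by (intro has_integral_mult_right has_integral_exp_minus_to_infinity) simp
  then have "((\<lambda>t. if t \<in> {A..} then A powr s * exp (- 1 * t) else 0) has_integral A powr s * exp (- A)) {0..}"
    using assms by (subst has_integral_restrict) auto
  moreover have "((\<lambda>t. t powr s / exp t) has_integral Gamma (s + 1)) {0..}"
    using Gamma_integral_real[of "s + 1"] assms by simp
  ultimately show ?thesis
    by (rule has_integral_le) (use assms in \<open>auto simp: exp_minus divide_inverse powr_mono2 intro!: mult_right_mono\<close>)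
qed

lemma rGamma_borel_measurable [measurable]: "(rGamma :: real \<Rightarrow> real) \<in> borel_measurable borel"
  by (intro borel_measurable_continuous_onI continuous_on_rGamma)

lemma rGamma_real_pos: "s > 0 \<Longrightarrow> rGamma (s::real) > 0"
  by (simp add: rGamma_inverse_Gamma Gamma_real_pos)

text \<open>
  Passing to the entire function \<open>1/\<Gamma>\<close> makes the joint Borel measurability of the integrand in
  \<open>x\<close> and \<open>s\<close> evident.
\<close>
lemma volterra_eq: "volterra x = (\<integral>s. indicator {0<..} s * (x powr (s - 1) * rGamma s) \<partial>lborel)"
proof -
  have "volterra x = (\<integral>s. indicator {0<..} s * (x powr (s - 1) * rGamma s) \<partial>lebesgue)"
    unfolding volterra_def set_lebesgue_integral_def
    by (intro Bochner_Integration.integral_cong) (auto simp: rGamma_inverse_Gamma divide_inverse)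
  also have "\<dots> = (\<integral>s. indicator {0<..} s * (x powr (s - 1) * rGamma s) \<partial>lborel)"
    by (rule integral_completion) measurable
  finally show ?thesis .
qed

lemma volterra_nonneg: "volterra x \<ge> 0"
  unfolding volterra_eq
  by (intro Bochner_Integration.integral_nonneg) (auto simp: indicator_def less_imp_le[OF rGamma_real_pos])

lemma volterra_measurable [measurable]: "volterra \<in> borel_measurable borel"
  unfolding volterra_eq[abs_def] by measurable

text \<open>
  By Tonelli, the integral over \<open>(0, T)\<close> is at most the integral of \<open>T\<^sup>s / (s \<Gamma>(s)) = T\<^sup>s / \<Gamma>(s + 1)\<close>
  over \<open>s > 0\<close>. The bound on \<open>\<Gamma>\<close> with \<open>A = 2 T\<close> dominates this by \<open>e\<^bsup>2T\<^esup> 2\<^bsup>-s\<^esup>\<close>.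
\<close>
lemma volterra_locally_integrable:
  assumes "T > 0"
  shows "integrable lborel (\<lambda>x. indicator {0<..<T} x * volterra x)"
proof (rule integrableI_nonneg)
  define p where "p = (\<lambda>x s. indicator {0<..} s * (x powr (s - 1) * rGamma s) :: real)"
  have p_nonneg: "p x s \<ge> 0" for x s
    by (auto simp: p_def indicator_def less_imp_le[OF rGamma_real_pos])
  have [measurable (raw)]: "(\<lambda>q. p (a q) (b q)) \<in> borel_measurable L"
    if [measurable]: "a \<in> borel_measurable L" "b \<in> borel_measurable L" for L :: "'c measure" and a b
    unfolding p_def by measurable
  have v: "volterra x = integral\<^sup>L lborel (p x)" for x
    by (simp add: volterra_eq p_def)
  \<comment> \<open>An inequality suffices; it also covers the points where the integral over \<open>s\<close> diverges
      and \<^const>\<open>volterra\<close> takes the default value \<open>0\<close>.\<close>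
  have le: "ennreal (volterra x) \<le> (\<integral>\<^sup>+s. ennreal (p x s) \<partial>lborel)" for x
  proof (cases "integrable lborel (p x)")
    case True
    then show ?thesis
      using p_nonneg by (simp add: v nn_integral_eq_integral)
  next
    case False
    then show ?thesis by (simp add: v not_integrable_integral_eq)
  qed
  have inner: "(\<integral>\<^sup>+x. indicator {0<..<T} x * ennreal (p x s) \<partial>lborel)
      \<le> ennreal (exp (2 * T)) * ennreal (indicator {0..} s * exp (- ln 2 * s))" for s
  proof (cases "s > 0")
    case True
    have "((\<lambda>x. x powr (s - 1)) has_integral (T powr (s - 1 + 1) / (s - 1 + 1))) {0..T}"
      using True assms by (intro has_integral_powr_from_0) auto
    then have I: "(\<integral>\<^sup>+x. ennreal (indicator {0..T} x * x powr (s - 1)) \<partial>lborel) = ennreal (T powr s / s)"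
      using nn_integral_has_integral_lebesgue[of "{0..T}" "\<lambda>x. x powr (s - 1)"] by simp
    have "(\<integral>\<^sup>+x. indicator {0<..<T} x * ennreal (p x s) \<partial>lborel)
       \<le> (\<integral>\<^sup>+x. ennreal (rGamma s) * ennreal (indicator {0..T} x * x powr (s - 1)) \<partial>lborel)"
      using True rGamma_real_pos[OF True]
      by (intro nn_integral_mono) (auto simp: p_def indicator_def mult.commute simp flip: ennreal_mult)
    also have "\<dots> = ennreal (rGamma s) * ennreal (T powr s / s)"
      by (subst nn_integral_cmult) (auto simp: I)
    also have "\<dots> = ennreal (T powr s / Gamma (s + 1))"
      using True rGamma_real_pos[OF True] Gamma_plus1[of s]
      by (auto simp: rGamma_inverse_Gamma divide_simps nonpos_Ints_def simp flip: ennreal_mult)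
    also have "T powr s / Gamma (s + 1) \<le> T powr s / ((2 * T) powr s * exp (- (2 * T)))"
      using True assms Gamma_plus1_ge[of s "2 * T"] by (intro divide_left_mono) auto
    also have "\<dots> = exp (2 * T) * exp (- ln 2 * s)"
      using assms by (simp add: powr_def ln_mult exp_minus exp_add field_simps)
    finally show ?thesis using True by (simp add: ennreal_mult ennreal_leI)
  qed (simp add: p_def)
  have "(\<integral>\<^sup>+x. ennreal (indicator {0<..<T} x * volterra x) \<partial>lborel)
      \<le> (\<integral>\<^sup>+x. indicator {0<..<T} x * (\<integral>\<^sup>+s. ennreal (p x s) \<partial>lborel) \<partial>lborel)"
    using le by (intro nn_integral_mono) (auto simp: indicator_def)
  also have "\<dots> = (\<integral>\<^sup>+x. \<integral>\<^sup>+s. indicator {0<..<T} x * ennreal (p x s) \<partial>lborel \<partial>lborel)"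
    by (simp add: nn_integral_cmult)
  also have "\<dots> = (\<integral>\<^sup>+s. \<integral>\<^sup>+x. indicator {0<..<T} x * ennreal (p x s) \<partial>lborel \<partial>lborel)"
    by (rule lborel_pair.Fubini') measurable
  also have "\<dots> \<le> (\<integral>\<^sup>+s. ennreal (exp (2 * T)) * ennreal (indicator {0..} s * exp (- ln 2 * s)) \<partial>lborel)"
    by (intro nn_integral_mono inner)
  also have "\<dots> = ennreal (exp (2 * T)) * ennreal (exp (- ln 2 * 0) / ln 2)"
    using nn_integral_has_integral_lebesgue[OF _ has_integral_exp_minus_to_infinity[of "ln 2" 0]]
    by (subst nn_integral_cmult) auto
  also have "\<dots> < \<infinity>" by (simp add: ennreal_mult_less_top)
  finally show "(\<integral>\<^sup>+x. ennreal (indicator {0<..<T} x * volterra x) \<partial>lborel) < \<infinity>" .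
qed (auto simp: volterra_nonneg)

section \<open>The norms and the operator in terms of Borel functions\<close>

lemma ennsqrt_square [simp]: "(ennsqrt a)\<^sup>2 = a"
  by (cases a) (auto simp: ennsqrt_def ennreal_power)

lemma ennsqrt_leI: "a \<le> b\<^sup>2 \<Longrightarrow> ennsqrt a \<le> b"
  by (cases a; cases b) (auto simp: ennsqrt_def ennreal_power real_le_lsqrt top_unique intro!: ennreal_leI)

lemma H12_norm_square: "(H12_norm T f)\<^sup>2 = (L2_norm T f)\<^sup>2 + (H12_seminorm T f)\<^sup>2"
  by (simp add: H12_norm_def)

lemma H12_seminorm_square: "(H12_seminorm T f)\<^sup>2 = gagliardo T f"
  unfolding H12_seminorm_def gagliardo_def ennsqrt_square nn_integral_completion
  by (intro nn_integral_cong) (auto simp: indicator_def gagliardo_quot_def)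

lemma gagliardo_cong_AE:
  assumes "AE x in lborel. x \<in> {0<..<T} \<longrightarrow> f x = g x"
  shows "gagliardo T f = gagliardo T g"
  unfolding gagliardo_def
proof (rule nn_integral_cong_AE, use assms in eventually_elim)
  case (elim x)
  show ?case
    by (rule nn_integral_cong_AE, use assms in eventually_elim)
       (use elim in \<open>auto simp: gagliardo_quot_def indicator_def\<close>)
qed

lemma L2_norm_square_ge: "(\<integral>\<^sup>+x. ennreal (\<bar>f x\<bar>\<^sup>2) * indicator {0<..<T} x \<partial>lborel) \<le> (L2_norm T f)\<^sup>2"
  by (simp add: L2_norm_def nn_integral_completion)

lemma volterra_prim_eq:
  assumes "x \<le> T"
  shows "volterra_prim x = (\<integral>s. indicator {0<..<T} s * volterra s * indicator {..<x} s \<partial>lborel)"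
proof -
  have "volterra_prim x = (\<integral>s. indicator {0<..<T} s * volterra s * indicator {..<x} s \<partial>lebesgue)"
    unfolding volterra_prim_def set_lebesgue_integral_def
    using assms by (intro Bochner_Integration.integral_cong) (auto simp: indicator_def)
  then show ?thesis by (simp add: integral_completion)
qed

text \<open>
  The value of the operator at each single point depends only on the almost-everywhere class of
  its argument; after replacing \<open>g\<close> by a Borel function, the reflection \<open>s \<mapsto> x - s\<close> moves the
  translation from the kernel to the function.
\<close>
lemma volterra_conv_eq:
  assumes x: "x \<in> {0<..<T}" and [measurable]: "h \<in> borel_measurable borel" and h_zero: "\<And>x. x \<le> 0 \<Longrightarrow> h x = 0"
    and g [measurable]: "g \<in> borel_measurable (lebesgue_on {0<..<T})"
    and ae: "AE x in lborel. x \<in> {0<..<T} \<longrightarrow> g x = h x"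
  shows "volterra_conv g x = (\<integral>s. indicator {0<..<T} s * volterra s * h (x - s) \<partial>lborel)"
proof -
  have "(\<lambda>s. if s \<in> {0<..<T} then g s else 0) \<in> borel_measurable lebesgue"
    using g by (rule borel_measurable_if_I) simp
  moreover have "(\<lambda>s. indicator {0<..<x} s * volterra (x - s)) \<in> borel_measurable lebesgue"
    by (rule measurable_completion) measurable
  ultimately have "(\<lambda>s. indicator {0<..<x} s * volterra (x - s) * (if s \<in> {0<..<T} then g s else 0))
      \<in> borel_measurable lebesgue" by measurable
  also have "(\<lambda>s. indicator {0<..<x} s * volterra (x - s) * (if s \<in> {0<..<T} then g s else 0))
      = (\<lambda>s. indicator {0<..<x} s *\<^sub>R (volterra (x - s) * g s))"
    using x by (auto simp: indicator_def)
  finally have m: "(\<lambda>s. indicator {0<..<x} s *\<^sub>R (volterra (x - s) * g s)) \<in> borel_measurable lebesgue" .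
  have m': "(\<lambda>s. indicator {0<..<x} s * (volterra (x - s) * h s)) \<in> borel_measurable lborel"
    by measurable
  have "volterra_conv g x = (\<integral>s. indicator {0<..<x} s * (volterra (x - s) * h s) \<partial>lebesgue)"
    unfolding volterra_conv_def set_lebesgue_integral_def
  proof (rule integral_cong_AE[OF m measurable_completion[OF m']])
    show "AE s in lebesgue. indicator {0<..<x} s *\<^sub>R (volterra (x - s) * g s)
        = indicator {0<..<x} s * (volterra (x - s) * h s)"
      using AE_completion[OF ae] by eventually_elim (use x in \<open>auto simp: indicator_def\<close>)
  qed
  also have "\<dots> = (\<integral>s. indicator {0<..<x} s * (volterra (x - s) * h s) \<partial>lborel)"
    by (rule integral_completion[OF m'])
  also have "\<dots> = (\<integral>s. indicator {0<..<x} (x - s) * (volterra s * h (x - s)) \<partial>lborel)"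
    by (subst lborel_integral_real_affine[where c = "-1" and t = x]) auto
  also have "\<dots> = (\<integral>s. indicator {0<..<T} s * volterra s * h (x - s) \<partial>lborel)"
  proof (intro Bochner_Integration.integral_cong refl)
    fix s show "indicator {0<..<x} (x - s) * (volterra s * h (x - s)) = indicator {0<..<T} s * volterra s * h (x - s)"
      using x h_zero[of "x - s"] by (cases "s < x") (auto simp: indicator_def)
  qed
  finally show ?thesis .
qed

text \<open>
  A Lebesgue measurable function need not give a measurable function of two variables on the
  product \<open>\<sigma>\<close>-algebra when composed with \<open>(x, s) \<mapsto> x - s\<close>, so Tonelli's theorem is applied to a
  Borel representative. Truncating it at the essential supremum makes the bound hold everywhere.
\<close>
lemma bounded_borel_representative:
  assumes "g \<in> Linf_space T"
  obtains h M where "h \<in> borel_measurable borel" "ennreal M = Linf_norm T g" "M \<ge> 0"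
    "\<And>x. \<bar>h x\<bar> \<le> M" "\<And>x. x \<notin> {0<..<T} \<Longrightarrow> h x = 0" "AE x in lborel. x \<in> {0<..<T} \<longrightarrow> g x = h x"
proof -
  define M where "M = enn2real (Linf_norm T g)"
  have g: "g \<in> borel_measurable (lebesgue_on {0<..<T})" and "Linf_norm T g < \<infinity>"
    using assms by (auto simp: Linf_space_def)
  then have M: "ennreal M = Linf_norm T g" "M \<ge> 0" by (auto simp: M_def)
  have "AE x in lebesgue_on {0<..<T}. ennreal \<bar>g x\<bar> \<le> ennreal M"
    unfolding M Linf_norm_def by (rule esssup_AE)
  then have bd: "AE x in lborel. x \<in> {0<..<T} \<longrightarrow> \<bar>g x\<bar> \<le> M"
    using M(2) by (subst (asm) AE_restrict_space_iff) (auto simp: AE_completion_iff)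
  have "(\<lambda>x. if x \<in> {0<..<T} then g x else 0) \<in> borel_measurable lebesgue"
    using g by (rule borel_measurable_if_I) simp
  then obtain g' where [measurable]: "g' \<in> borel_measurable lborel"
    and g': "AE x in lborel. (if x \<in> {0<..<T} then g x else 0) = g' x"
    using completion_ex_borel_measurable_real by blast
  define h where "h = (\<lambda>x. if x \<in> {0<..<T} \<and> \<bar>g' x\<bar> \<le> M then g' x else 0)"
  show ?thesis
  proof
    show "h \<in> borel_measurable borel" unfolding h_def by measurable
    show "AE x in lborel. x \<in> {0<..<T} \<longrightarrow> g x = h x"
      using bd g' by eventually_elim (auto simp: h_def)
  qed (use M in \<open>auto simp: h_def\<close>)
qed

section \<open>The norm estimate\<close>

theorem theorem5p2:
  shows "\<exists>c::real. c > 0 \<and>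
    (\<forall>T::real. T > 0 \<longrightarrow>
      (\<forall>g \<in> H12_space T \<inter> Linf_space T.
        H12_norm T (volterra_conv g)
          \<le> ennreal c * max (H12_norm T volterra_prim) (ennreal (volterra_prim T))
              * (Linf_norm T g + H12_norm T g)))"
proof (intro exI[of _ 2] conjI allI impI ballI)
  fix T :: real and g assume T: "T > 0" and g: "g \<in> H12_space T \<inter> Linf_space T"
  obtain h M where [measurable]: "h \<in> borel_measurable borel" and M: "ennreal M = Linf_norm T g" "M \<ge> 0"
    and h_bound: "\<And>x. \<bar>h x\<bar> \<le> M" and h_out: "\<And>x. x \<notin> {0<..<T} \<Longrightarrow> h x = 0"
    and ae: "AE x in lborel. x \<in> {0<..<T} \<longrightarrow> g x = h x"
    using bounded_borel_representative[of g T] g by blast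
  have g_meas: "g \<in> borel_measurable (lebesgue_on {0<..<T})" using g by (simp add: Linf_space_def)
  have h_zero: "h x = 0" if "x \<le> 0" for x using h_out[of x] that by simp
  define K where "K = (\<lambda>s. indicator {0<..<T} s * volterra s)"
  have K: "integrable lborel K" "\<And>s. K s \<ge> 0" "\<And>s. s \<le> 0 \<Longrightarrow> K s = 0"
    using volterra_locally_integrable[OF T] volterra_nonneg by (auto simp: K_def)
  interpret causal_convolution K h M
    using K h_bound h_zero by unfold_locales auto
  define u where "u = (\<lambda>x. \<integral>s. K s * h (x - s) \<partial>lborel)"
  define N where "N = (\<lambda>x. \<integral>s. K s * indicator {..<x} s \<partial>lborel)"
  have [measurable]: "u \<in> borel_measurable borel" unfolding u_def by measurable
  have [measurable]: "N \<in> borel_measurable borel" unfolding N_def lessThan_def by measurable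
  have conv: "volterra_conv g x = u x" if "x \<in> {0<..<T}" for x
    using volterra_conv_eq[OF that _ h_zero g_meas ae] by (simp add: u_def K_def)
  have prim: "volterra_prim x = N x" if "x \<le> T" for x
    using volterra_prim_eq[OF that] by (simp add: N_def K_def)
  have NT: "N T = integral\<^sup>L lborel K"
    unfolding N_def by (intro Bochner_Integration.integral_cong) (auto simp: K_def indicator_def)
  have N_nonneg: "N x \<ge> 0" for x
    unfolding N_def using K by (intro Bochner_Integration.integral_nonneg) (auto simp: indicator_def)

  define L G H P where "L = Linf_norm T g" and "G = H12_norm T g"
    and "H = H12_norm T volterra_prim" and "P = ennreal (volterra_prim T)"
  have seminorm: "(H12_seminorm T (volterra_conv g))\<^sup>2
      \<le> 2 * P\<^sup>2 * (H12_seminorm T g)\<^sup>2 + 2 * L\<^sup>2 * (H12_seminorm T volterra_prim)\<^sup>2"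
  proof -
    have "gagliardo T (volterra_conv g) = gagliardo T u"
      using conv by (intro gagliardo_cong_AE) auto
    also have "\<dots> \<le> 2 * ennreal ((integral\<^sup>L lborel K)\<^sup>2) * gagliardo T h + 2 * ennreal (M\<^sup>2) * gagliardo T N"
      unfolding u_def N_def by (rule gagliardo_conv_le)
    also have "gagliardo T h = gagliardo T g"
      using ae by (intro gagliardo_cong_AE) auto
    also have "gagliardo T N = gagliardo T volterra_prim"
      using prim by (intro gagliardo_cong_AE) auto
    finally show ?thesis
      using M(2) N_nonneg[of T]
      by (simp add: H12_seminorm_square P_def L_def prim NT ennreal_power flip: M(1))
  qed
  have L2: "(L2_norm T (volterra_conv g))\<^sup>2 \<le> L\<^sup>2 * (L2_norm T volterra_prim)\<^sup>2"
  proof -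
    have "volterra_conv g \<in> borel_measurable (lebesgue_on {0<..<T})
        \<longleftrightarrow> u \<in> borel_measurable (lebesgue_on {0<..<T})"
      using conv by (intro measurable_cong) auto
    moreover have "u \<in> borel_measurable (lebesgue_on {0<..<T})"
      by (intro measurable_restrict_space1 measurable_completion) auto
    ultimately have "(L2_norm T (volterra_conv g))\<^sup>2
        = (\<integral>\<^sup>+x. ennreal (\<bar>volterra_conv g x\<bar>\<^sup>2) * indicator {0<..<T} x \<partial>lborel)"
      by (simp add: L2_norm_def nn_integral_completion)
    also have "\<dots> \<le> (\<integral>\<^sup>+x. L\<^sup>2 * (ennreal (\<bar>N x\<bar>\<^sup>2) * indicator {0<..<T} x) \<partial>lborel)"
    proof (intro nn_integral_mono)
      fix x
      have "\<bar>u x\<bar> \<le> M * N x"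
        unfolding u_def N_def by (rule conv_le)
      then have "\<bar>u x\<bar>\<^sup>2 \<le> (M * N x)\<^sup>2" by (rule power_mono) simp
      then have "ennreal (\<bar>u x\<bar>\<^sup>2) \<le> L\<^sup>2 * ennreal (\<bar>N x\<bar>\<^sup>2)"
        using M(2) by (simp add: L_def ennreal_power power_mult_distrib flip: M(1) ennreal_mult)
      then show "ennreal (\<bar>volterra_conv g x\<bar>\<^sup>2) * indicator {0<..<T} x
          \<le> L\<^sup>2 * (ennreal (\<bar>N x\<bar>\<^sup>2) * indicator {0<..<T} x)"
        using conv[of x] by (auto simp: indicator_def)
    qed
    also have "\<dots> = L\<^sup>2 * (\<integral>\<^sup>+x. ennreal (\<bar>N x\<bar>\<^sup>2) * indicator {0<..<T} x \<partial>lborel)"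
      by (rule nn_integral_cmult) measurable
    also have "(\<integral>\<^sup>+x. ennreal (\<bar>N x\<bar>\<^sup>2) * indicator {0<..<T} x \<partial>lborel)
        = (\<integral>\<^sup>+x. ennreal (\<bar>volterra_prim x\<bar>\<^sup>2) * indicator {0<..<T} x \<partial>lborel)"
      using prim by (intro nn_integral_cong) (auto simp: indicator_def)
    also have "\<dots> \<le> (L2_norm T volterra_prim)\<^sup>2" by (rule L2_norm_square_ge)
    finally show ?thesis by (simp add: mult_left_mono)
  qed

  \<comment> \<open>With \<open>m\<close> the maximum, the two estimates add up to at most \<open>2 m\<^sup>2 (L\<^sup>2 + G\<^sup>2)\<close>; this is below
      \<open>(2 m (L + G))\<^sup>2\<close>, whence the constant \<open>2\<close>.\<close>
  define m where "m = max H P"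
  have "(L2_norm T (volterra_conv g))\<^sup>2 + (H12_seminorm T (volterra_conv g))\<^sup>2
      \<le> L\<^sup>2 * (L2_norm T volterra_prim)\<^sup>2
        + (2 * P\<^sup>2 * (H12_seminorm T g)\<^sup>2 + 2 * L\<^sup>2 * (H12_seminorm T volterra_prim)\<^sup>2)"
    by (intro add_mono L2 seminorm)
  also have "\<dots> \<le> 2 * L\<^sup>2 * (L2_norm T volterra_prim)\<^sup>2
        + (2 * P\<^sup>2 * (H12_seminorm T g)\<^sup>2 + 2 * L\<^sup>2 * (H12_seminorm T volterra_prim)\<^sup>2)"
    by (intro add_mono mult_right_mono order_refl) (auto simp: mult_2)
  also have "\<dots> = 2 * (L\<^sup>2 * H\<^sup>2 + P\<^sup>2 * (H12_seminorm T g)\<^sup>2)"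
    by (simp add: H_def H12_norm_square algebra_simps)
  also have "\<dots> \<le> 2 * (L\<^sup>2 * m\<^sup>2 + m\<^sup>2 * G\<^sup>2)"
    by (intro mult_left_mono add_mono mult_mono) (auto simp: m_def G_def H12_norm_square intro!: power_mono)
  also have "\<dots> = 2 * m\<^sup>2 * (L\<^sup>2 + G\<^sup>2)"
    by (simp add: algebra_simps)
  also have "\<dots> \<le> 4 * m\<^sup>2 * (L + G)\<^sup>2"
    by (intro mult_mono) (auto simp: power2_eq_square algebra_simps)
  also have "\<dots> = (2 * m * (L + G))\<^sup>2"
    by (simp add: power_mult_distrib)
  finally show "H12_norm T (volterra_conv g) \<le> ennreal 2 * max (H12_norm T volterra_prim) (ennreal (volterra_prim T))
              * (Linf_norm T g + H12_norm T g)"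
    unfolding H12_norm_def[of T "volterra_conv g"]
    by (intro ennsqrt_leI) (simp add: m_def L_def G_def H_def P_def)
qed simp

end
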